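(* Let $G$ be a non-complete graph with complement $\overline{G}$, and let $\mathcal{H}_G$ be the hypergraph with vertex set $E(\overline{G})$ whose hyperedges are the subsets $E\subseteq E(\overline{G})$ that induce a cointerval subgraph of $\overline{G}$. Then $$\mathrm{box}(G)\;\geq\;\mathrm{box}_f(G)\;\geq\;\frac{|E(\overline{G})|}{\max_{E_i\in E(\mathcal{H}_G)}|E_i|}.$$ Moreover, if $\overline{G}$ is edge-transitive, then $$\mathrm{box}_f(G)=\frac{|E(\overline{G})|}{\max_{E_i\in E(\mathcal{H}_G)}|E_i|}.$$
   Context: All graphs are finite, simple and undirected; $V(\cdot)$ and $E(\cdot)$ denote vertex sets and (hyper)edge sets of graphs and hypergraphs, and $\overline{G}$ is the complement of $G$. A box in Euclidean $k$-space is the Cartesian product of $k$ closed intervals on the real line. The boxicity $\mathrm{box}(G)$ is the minimum non-negative integer $k$ such that $G$ is isomorphic to the intersection graph of a family of boxes in Euclidean $k$-space (complete graphs have boxicity $0$). A graph is interval if its boxicity is at most $1$ (i.e. it is the intersection graph of a family of closed intervals on the real line), and cointerval if its complement is an interval graph. A set $E\subseteq E(\overline{G})$ induces the subgraph of $\overline{G}$ whose edge set is $E$ and whose vertices are the endpoints of edges in $E$. Write $E(\mathcal{H}_G)=\{E_1,\dots,E_n\}$ and let $M_G$ be the incidence matrix of $\mathcal{H}_G$: rows are indexed by the edges $e_i$ of $\overline{G}$, columns by the hyperedges $E_j$, and the $(i,j)$ entry is $1$ if $e_i\in E_j$ and $0$ otherwise. The fractional boxicity of $G$ is $$\mathrm{box}_f(G)=\min\Big\{\sum_{j=1}^n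 x_j \;:\; M_G\boldsymbol{x}\geq \boldsymbol{1},\ \boldsymbol{x}\geq 0,\ \boldsymbol{x}\in\mathbb{R}^n\Big\},$$ with inequalities understood coordinatewise. A graph is edge-transitive if for every pair of edges $w_1,w_2$ there is an automorphism $\pi$ of the graph with $\pi(w_1)=w_2$. *)

theory Defs
  imports Complex_Main "HOL-Library.FuncSet" "HOL-Library.Ramsey"
begin

text \<open>Graphs and hypergraphs share one type; an edge is the set of the vertices it contains.\<close>

datatype 'a hypergraph = Hypergraph (verts: "'a set") (edges: "'a set set")

definition simple_graph :: "'a hypergraph \<Rightarrow> bool" where
  "simple_graph G \<longleftrightarrow> finite (verts G) \<and> edges G \<subseteq> nsets (verts G) 2"

definition complete_graph :: "'a hypergraph \<Rightarrow> bool" where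
  "complete_graph G \<longleftrightarrow> edges G = nsets (verts G) 2"

definition graph_complement :: "'a hypergraph \<Rightarrow> 'a hypergraph" where
  "graph_complement G = Hypergraph (verts G) (nsets (verts G) 2 - edges G)"

definition graph_iso :: "('a \<Rightarrow> 'b) \<Rightarrow> 'a hypergraph \<Rightarrow> 'b hypergraph \<Rightarrow> bool" where
  "graph_iso f G H \<longleftrightarrow> bij_betw f (verts G) (verts H) \<and> (\<lambda>e. f ` e) ` edges G = edges H"

definition edge_transitive :: "'a hypergraph \<Rightarrow> bool" where
  "edge_transitive G \<longleftrightarrow>
     (\<forall>w1\<in>edges G. \<forall>w2\<in>edges G. \<exists>\<pi>. graph_iso \<pi> G G \<and> \<pi> ` w1 = w2)"

text \<open>Euclidean \<open>k\<close>-space is rendered as the extensional functions on \<open>{..<k}\<close>, since \<open>k\<close> varies.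
  For \<open>k = 0\<close> it is a single point, and that point is the only box.\<close>

definition is_box :: "nat \<Rightarrow> (nat \<Rightarrow> real) set \<Rightarrow> bool" where
  "is_box k B \<longleftrightarrow> (\<exists>a b. (\<forall>i<k. a i \<le> b i) \<and> B = (\<Pi>\<^sub>E i\<in>{..<k}. {a i..b i}))"

text \<open>Families are indexed, so that different indices may carry the same set.\<close>

definition intersection_graph :: "'i set \<Rightarrow> ('i \<Rightarrow> 'b set) \<Rightarrow> 'i hypergraph" where
  "intersection_graph I B =
     Hypergraph I {{i, j} | i j. i \<in> I \<and> j \<in> I \<and> i \<noteq> j \<and> B i \<inter> B j \<noteq> {}}"

text \<open>Taking the indices from the vertex type is no restriction: a family whose intersection
  graph is isomorphic to \<open>G\<close> can be reindexed by \<open>verts G\<close>.\<close>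

definition box_representable :: "'a hypergraph \<Rightarrow> nat \<Rightarrow> bool" where
  "box_representable G k \<longleftrightarrow>
     (\<exists>(I :: 'a set) B f. (\<forall>i\<in>I. is_box k (B i)) \<and> graph_iso f G (intersection_graph I B))"

definition boxicity :: "'a hypergraph \<Rightarrow> nat" where
  "boxicity G = (LEAST k. box_representable G k)"

definition interval_graph :: "'a hypergraph \<Rightarrow> bool" where
  "interval_graph G \<longleftrightarrow> boxicity G \<le> 1"

definition cointerval_graph :: "'a hypergraph \<Rightarrow> bool" where
  "cointerval_graph G \<longleftrightarrow> interval_graph (graph_complement G)"

definition edge_induced :: "'a set set \<Rightarrow> 'a hypergraph" where
  "edge_induced E = Hypergraph (\<Union>E) E"

definition cointerval_hypergraph :: "'a hypergraph \<Rightarrow> 'a set hypergraph" where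
  "cointerval_hypergraph G = Hypergraph (edges (graph_complement G))
     {E. E \<subseteq> edges (graph_complement G) \<and> cointerval_graph (edge_induced E)}"

text \<open>The rows and columns of the incidence matrix, and the coordinates of \<open>x\<close> below, are indexed
  by the vertices and hyperedges themselves rather than by an enumeration of them.\<close>

definition incidence :: "'a hypergraph \<Rightarrow> 'a \<Rightarrow> 'a set \<Rightarrow> real" where
  "incidence H v F = (if v \<in> verts H \<and> F \<in> edges H \<and> v \<in> F then 1 else 0)"

definition fractional_cover :: "'a hypergraph \<Rightarrow> ('a set \<Rightarrow> real) \<Rightarrow> bool" where
  "fractional_cover H x \<longleftrightarrow>
     (\<forall>v\<in>verts H. (\<Sum>F\<in>edges H. incidence H v F * x F) \<ge> 1) \<and> (\<forall>F\<in>edges H. x F \<ge> 0)"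

text \<open>\<open>LEAST\<close> denotes a genuine minimum, not merely an infimum.\<close>

definition fractional_boxicity :: "'a hypergraph \<Rightarrow> real" where
  "fractional_boxicity G =
     (LEAST r. \<exists>x. fractional_cover (cointerval_hypergraph G) x \<and>
                   r = (\<Sum>F\<in>edges (cointerval_hypergraph G). x F))"

end

theory Submission
  imports Defs "HOL-Analysis.Function_Topology"
begin

text \<open>
  Splitting a box representation of \<open>G\<close> into its coordinates covers the edges of the complement
  by \<open>k\<close> hyperedges, which is an integral cover. The lower bound comes from summing the
  covering constraints over all vertices of the hypergraph. In the edge-transitive case, the
  hyperedges of maximum size are permuted by the automorphisms, so that each edge lies in equally
  many of them, and a uniform weight on these hyperedges attains the bound.
\<close>

section \<open>Box representations by interval endpoints\<close>

lemma graph_iso_doubleton_iff: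
  assumes iso: "graph_iso f G H" and sub: "edges G \<subseteq> nsets (verts G) 2"
    and uv: "u \<in> verts G" "v \<in> verts G"
  shows "{f u, f v} \<in> edges H \<longleftrightarrow> {u, v} \<in> edges G"
proof
  assume "{u, v} \<in> edges G"
  then have "f ` {u, v} \<in> edges H" using iso unfolding graph_iso_def by blast
  then show "{f u, f v} \<in> edges H" by simp
next
  assume "{f u, f v} \<in> edges H"
  then obtain e where e: "e \<in> edges G" "f ` {u, v} = f ` e"
    using iso unfolding graph_iso_def by (metis image_empty image_iff image_insert)
  have "inj_on f (verts G)" using iso by (auto simp: graph_iso_def bij_betw_def)
  moreover have "e \<subseteq> verts G" using e sub by (auto simp: nsets_def)
  ultimately have "{u, v} = e" using e uv by (metis empty_subsetI inj_on_image_eq_iff insert_subset)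
  then show "{u, v} \<in> edges G" using e by simp
qed

text \<open>Two nonempty boxes meet exactly when they meet in each coordinate, and two closed
  intervals meet exactly when each starts no later than the other ends. This removes index sets and
  isomorphisms from the rest of the argument, which handles endpoints only.\<close>

lemma box_representable_iff:
  assumes sub: "edges G \<subseteq> nsets (verts G) 2"
  shows "box_representable G k \<longleftrightarrow>
    (\<exists>a b. (\<forall>v\<in>verts G. \<forall>i<k. a v i \<le> b v i) \<and>
       (\<forall>u\<in>verts G. \<forall>v\<in>verts G. u \<noteq> v \<longrightarrow>
          ({u, v} \<in> edges G \<longleftrightarrow> (\<forall>i<k. a u i \<le> b v i \<and> a v i \<le> (b u i :: real)))))"
    (is "?L \<longleftrightarrow> ?R")
proof -
  \<comment> \<open>The intersection is again a product of intervals, and a product is empty only if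
    some factor is. For \<open>k = 0\<close> both sides are true.\<close>
  have inter: "(\<Pi>\<^sub>E i\<in>{..<k}. {a u i..b u i}) \<inter> (\<Pi>\<^sub>E i\<in>{..<k}. {a v i..b v i}) \<noteq> {} \<longleftrightarrow>
      (\<forall>i<k. a u i \<le> b v i \<and> a v i \<le> b u i)"
    if "\<forall>i<k. a u i \<le> b u i" "\<forall>i<k. a v i \<le> b v i"
    for a b :: "'a \<Rightarrow> nat \<Rightarrow> real" and u v
    using that by (auto simp: PiE_Int PiE_eq_empty_iff)
  show ?thesis
  proof
    assume ?L
    then obtain I :: "'a set" and B f where box: "\<forall>i\<in>I. is_box k (B i)"
      and iso: "graph_iso f G (intersection_graph I B)"
      unfolding box_representable_def by blast
    have bij: "bij_betw f (verts G) I" using iso by (simp add: graph_iso_def intersection_graph_def)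
    have "\<forall>v\<in>verts G. \<exists>a b. (\<forall>i<k. a i \<le> b i) \<and> B (f v) = (\<Pi>\<^sub>E i\<in>{..<k}. {a i..b i})"
      using box bij unfolding is_box_def bij_betw_def by blast
    then obtain a b where ab: "\<forall>v\<in>verts G. (\<forall>i<k. a v i \<le> b v i) \<and>
        B (f v) = (\<Pi>\<^sub>E i\<in>{..<k}. {a v i..b v i})"
      by metis
    have "{u, v} \<in> edges G \<longleftrightarrow> (\<forall>i<k. a u i \<le> b v i \<and> a v i \<le> b u i)"
      if "u \<in> verts G" "v \<in> verts G" "u \<noteq> v" for u v
    proof -
      have I: "f u \<in> I" "f v \<in> I" "f u \<noteq> f v"
        using bij that by (auto simp: bij_betw_def inj_on_def)
      have "{u, v} \<in> edges G \<longleftrightarrow> {f u, f v} \<in> edges (intersection_graph I B)"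
        using graph_iso_doubleton_iff[OF iso sub] that by blast
      also have "\<dots> \<longleftrightarrow> B (f u) \<inter> B (f v) \<noteq> {}"
        using I by (auto simp: intersection_graph_def doubleton_eq_iff)
      also have "\<dots> \<longleftrightarrow> (\<forall>i<k. a u i \<le> b v i \<and> a v i \<le> b u i)"
        using ab that inter[of a u b v] by simp
      finally show ?thesis .
    qed
    then show ?R using ab by blast
  next
    assume ?R
    then obtain a b :: "'a \<Rightarrow> nat \<Rightarrow> real" where ab: "\<forall>v\<in>verts G. \<forall>i<k. a v i \<le> b v i"
      and E: "\<And>u v. u \<in> verts G \<Longrightarrow> v \<in> verts G \<Longrightarrow> u \<noteq> v \<Longrightarrow>
          ({u, v} \<in> edges G \<longleftrightarrow> (\<forall>i<k. a u i \<le> b v i \<and> a v i \<le> b u i))"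
      by blast
    define B where "B v = (\<Pi>\<^sub>E i\<in>{..<k}. {a v i..b v i})" for v
    have E': "{u, v} \<in> edges G \<longleftrightarrow> B u \<inter> B v \<noteq> {}"
      if "u \<in> verts G" "v \<in> verts G" "u \<noteq> v" for u v
      using E[OF that] inter[of a u b v] ab that by (simp add: B_def)
    have box: "\<forall>v\<in>verts G. is_box k (B v)"
      unfolding is_box_def B_def using ab by blast
    have "edges G = {{u, v} | u v. u \<in> verts G \<and> v \<in> verts G \<and> u \<noteq> v \<and> B u \<inter> B v \<noteq> {}}"
      (is "_ = ?S")
    proof
      show "edges G \<subseteq> ?S"
      proof
        fix e assume e: "e \<in> edges G"
        then obtain u v where uv: "e = {u, v}" "u \<in> verts G" "v \<in> verts G" "u \<noteq> v"
          using sub by (meson nsets2_E subsetD)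
        then show "e \<in> ?S" using E'[of u v] e by blast
      qed
    next
      show "?S \<subseteq> edges G" using E' by auto
    qed
    then have "graph_iso id G (intersection_graph (verts G) B)"
      by (simp add: graph_iso_def intersection_graph_def)
    then show ?L using box unfolding box_representable_def by blast
  qed
qed

text \<open>Since \<open>boxicity\<close> is a \<open>LEAST\<close>, some representation must exist
  before \<open>boxicity G\<close> can be known to be the dimension of one.\<close>

lemma ex_box_representable:
  assumes fin: "finite (verts G)" and sub: "edges G \<subseteq> nsets (verts G) 2"
  shows "\<exists>k. box_representable G k"
proof -
  define N where "N = nsets (verts G) 2 - edges G"
  have "finite N" using fin by (auto simp: N_def finite_imp_finite_nsets)
  then obtain es where es: "set es = N" using finite_list by blast
  define p where "p e = (SOME u. u \<in> e)" for e :: "'a set"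
  have p: "p e \<in> e" if "e \<in> N" for e
  proof -
    have "e \<noteq> {}" using that by (auto simp: N_def nsets_def)
    then show ?thesis by (simp add: p_def some_in_eq)
  qed
  \<comment> \<open>Coordinate \<open>i\<close> separates only the two ends of the non-edge \<open>es ! i\<close>: one end gets \<open>{0}\<close>,
    the other \<open>{1}\<close>, and every other vertex \<open>{0..1}\<close>.\<close>
  define a where "a v i = (if v \<in> es ! i \<and> v \<noteq> p (es ! i) then 1 else 0 :: real)" for v i
  define b where "b v i = (if v = p (es ! i) then 0 else 1 :: real)" for v i
  have "{u, v} \<in> edges G \<longleftrightarrow> (\<forall>i<length es. a u i \<le> b v i \<and> a v i \<le> b u i)"
    if uv: "u \<in> verts G" "v \<in> verts G" "u \<noteq> v" for u v
  proof
    assume e: "{u, v} \<in> edges G"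
    show "\<forall>i<length es. a u i \<le> b v i \<and> a v i \<le> b u i"
    proof (intro allI impI)
      fix i assume "i < length es"
      then have i: "es ! i \<in> N" using es by auto
      then obtain x y where xy: "es ! i = {x, y}" "x \<noteq> y" unfolding N_def by (meson DiffD1 nsets2_E)
      \<comment> \<open>Hence one of \<open>u\<close>, \<open>v\<close> lies outside
        \<open>es ! i\<close>. Its interval there is all of \<open>{0..1}\<close>, which meets every
        interval used in coordinate \<open>i\<close>.\<close>
      have "es ! i \<noteq> {u, v}" using i e by (auto simp: N_def)
      then show "a u i \<le> b v i \<and> a v i \<le> b u i"
        using xy p[OF i] uv by (auto simp: a_def b_def)
    qed
  next
    assume *: "\<forall>i<length es. a u i \<le> b v i \<and> a v i \<le> b u i"
    show "{u, v} \<in> edges G"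
    proof (rule ccontr)
      assume "{u, v} \<notin> edges G"
      then have N: "{u, v} \<in> N" using uv by (auto simp: N_def doubleton_in_nsets_2)
      then obtain i where i: "i < length es" "es ! i = {u, v}" using es by (metis in_set_conv_nth)
      with p[OF N] have "p (es ! i) = u \<or> p (es ! i) = v" by auto
      then show False using * i uv by (auto simp: a_def b_def)
    qed
  qed
  moreover have "a v i \<le> b v i" for v i by (simp add: a_def b_def)
  ultimately show ?thesis unfolding box_representable_iff[OF sub] by blast
qed

lemma interval_graph_iff:
  assumes "finite (verts G)" and sub: "edges G \<subseteq> nsets (verts G) 2"
  shows "interval_graph G \<longleftrightarrow>
    (\<exists>a b. (\<forall>v\<in>verts G. a v \<le> b v) \<and>
       (\<forall>u\<in>verts G. \<forall>v\<in>verts G. u \<noteq> v \<longrightarrow>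
          ({u, v} \<in> edges G \<longleftrightarrow> a u \<le> b v \<and> a v \<le> (b u :: real))))" (is "_ \<longleftrightarrow> ?R")
proof
  assume "interval_graph G"
  moreover have "box_representable G (boxicity G)"
    unfolding boxicity_def using ex_box_representable[OF assms] by (rule LeastI_ex)
  ultimately consider "box_representable G 0" | "box_representable G 1"
    unfolding interval_graph_def by (metis One_nat_def le_Suc_eq le_zero_eq)
  then show ?R
  proof cases
    case 1
    \<comment> \<open>With no coordinate to separate them, all distinct vertices are adjacent, so
      one common interval serves every vertex.\<close>
    then have "\<forall>u\<in>verts G. \<forall>v\<in>verts G. u \<noteq> v \<longrightarrow> {u, v} \<in> edges G"
      unfolding box_representable_iff[OF sub] by simp
    then show ?thesis by (intro exI[of _ "\<lambda>_. 0"]) simp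
  next
    case 2
    then obtain a b :: "'a \<Rightarrow> nat \<Rightarrow> real" where
      "(\<forall>v\<in>verts G. \<forall>i<1. a v i \<le> b v i) \<and> (\<forall>u\<in>verts G. \<forall>v\<in>verts G. u \<noteq> v \<longrightarrow>
        ({u, v} \<in> edges G \<longleftrightarrow> (\<forall>i<1. a u i \<le> b v i \<and> a v i \<le> b u i)))"
      unfolding box_representable_iff[OF sub] by (elim exE)
    then show ?thesis by (intro exI[of _ "\<lambda>v. a v 0"] exI[of _ "\<lambda>v. b v 0"]) simp
  qed
next
  assume ?R
  then obtain a b :: "'a \<Rightarrow> real" where "\<forall>v\<in>verts G. a v \<le> b v"
    "\<forall>u\<in>verts G. \<forall>v\<in>verts G. u \<noteq> v \<longrightarrow> ({u, v} \<in> edges G \<longleftrightarrow> a u \<le> b v \<and> a v \<le> b u)" by blast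
  then have "box_representable G 1"
    unfolding box_representable_iff[OF sub]
    by (intro exI[of _ "\<lambda>v _. a v"] exI[of _ "\<lambda>v _. b v"]) simp
  then show "interval_graph G" unfolding interval_graph_def boxicity_def by (rule Least_le)
qed

text \<open>Complementing turns "the intervals meet" into "one lies strictly to the left of the
  other", so \<open>E\<close> itself becomes the disjointness relation of the intervals. The
  complement is taken within \<open>\<Union>E\<close>, so only endpoints of edges in
  \<open>E\<close> carry an interval.\<close>

lemma cointerval_edge_induced_iff:
  assumes "finite V" and "E \<subseteq> nsets V 2"
  shows "cointerval_graph (edge_induced E) \<longleftrightarrow>
    (\<exists>a b. (\<forall>v\<in>\<Union>E. a v \<le> b v) \<and>
       (\<forall>u\<in>\<Union>E. \<forall>v\<in>\<Union>E. u \<noteq> v \<longrightarrow> ({u, v} \<in> E \<longleftrightarrow> b v < a u \<or> (b u :: real) < a v)))"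
proof -
  let ?C = "graph_complement (edge_induced E)"
  have C: "verts ?C = \<Union>E" "edges ?C = nsets (\<Union>E) 2 - E"
    by (simp_all add: graph_complement_def edge_induced_def)
  have fin: "finite (verts ?C)"
    unfolding C using assms by (intro finite_subset[of "\<Union>E" V]) (auto simp: nsets_def)
  have iff: "(u \<noteq> v \<longrightarrow> ({u, v} \<in> nsets (\<Union>E) 2 - E \<longleftrightarrow> a u \<le> b v \<and> a v \<le> b u)) \<longleftrightarrow>
      (u \<noteq> v \<longrightarrow> ({u, v} \<in> E \<longleftrightarrow> b v < a u \<or> b u < a v))"
    if "u \<in> \<Union>E" "v \<in> \<Union>E" for a b :: "'a \<Rightarrow> real" and u v
  proof (cases "u = v")
    case False
    then have "{u, v} \<in> nsets (\<Union>E) 2"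
      using that by (simp only: doubleton_in_nsets_2 simp_thms not_False_eq_True)
    then show ?thesis by (simp only: Diff_iff simp_thms flip: not_le) blast
  qed simp
  have sub: "edges ?C \<subseteq> nsets (verts ?C) 2" unfolding C by blast
  have "(\<forall>u\<in>\<Union>E. \<forall>v\<in>\<Union>E. u \<noteq> v \<longrightarrow>
        ({u, v} \<in> nsets (\<Union>E) 2 - E \<longleftrightarrow> a u \<le> b v \<and> a v \<le> b u)) \<longleftrightarrow>
      (\<forall>u\<in>\<Union>E. \<forall>v\<in>\<Union>E. u \<noteq> v \<longrightarrow> ({u, v} \<in> E \<longleftrightarrow> b v < a u \<or> b u < a v))"
    for a b :: "'a \<Rightarrow> real"
    by (rule ball_cong[OF refl], rule ball_cong[OF refl], rule iff)
  then show ?thesis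
    unfolding cointerval_graph_def interval_graph_iff[OF fin sub] C by (simp only:)
qed

text \<open>Two distinct points on the line represent the ends of a single edge. Singleton
  hyperedges later make the covering problem feasible and the maximum hyperedge size
  positive.\<close>

lemma cointerval_edge_induced_single:
  assumes "e \<in> nsets V 2"
  shows "cointerval_graph (edge_induced {e})"
proof -
  obtain x y where e: "e = {x, y}" "x \<noteq> y" using assms by (rule nsets2_E)
  have sub: "{e} \<subseteq> nsets e 2" and fin: "finite e" using e by (auto simp: doubleton_in_nsets_2)
  \<comment> \<open>Used for both endpoints, so that \<open>x\<close> gets the point 0 and
    \<open>y\<close> the point 1.\<close>
  let ?a = "\<lambda>v. if v = x then 0 else 1 :: real"
  show ?thesis
    unfolding cointerval_edge_induced_iff[OF fin sub]
    by (intro exI[of _ ?a]) (simp add: e e(2)[symmetric] insert_commute)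
qed

text \<open>The intervals are transported along the relabelling: \<open>\<pi> v\<close> inherits the
  interval of \<open>v\<close>, read off through the inverse \<open>q\<close>. Injectivity on
  \<open>V\<close> ensures that no new pair becomes an edge of the image.\<close>

lemma cointerval_edge_induced_image:
  assumes fin: "finite V" and E: "E \<subseteq> nsets V 2" and inj: "inj_on \<pi> V"
    and co: "cointerval_graph (edge_induced E)"
  shows "cointerval_graph (edge_induced ((`) \<pi> ` E))"
proof -
  obtain a b :: "_ \<Rightarrow> real" where ab: "\<And>v. v \<in> \<Union>E \<Longrightarrow> a v \<le> b v"
    and iff: "\<And>u v. u \<in> \<Union>E \<Longrightarrow> v \<in> \<Union>E \<Longrightarrow> u \<noteq> v \<Longrightarrow> {u, v} \<in> E \<longleftrightarrow> b v < a u \<or> b u < a v"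
    using co unfolding cointerval_edge_induced_iff[OF fin E] by blast
  have sub: "(`) \<pi> ` E \<subseteq> nsets (\<pi> ` V) 2"
  proof
    fix e' assume "e' \<in> (`) \<pi> ` E"
    then obtain e where "e \<in> E" "e' = \<pi> ` e" by blast
    moreover obtain u v where "e = {u, v}" "u \<in> V" "v \<in> V" "u \<noteq> v"
      using E \<open>e \<in> E\<close> by (meson nsets2_E subsetD)
    ultimately show "e' \<in> nsets (\<pi> ` V) 2"
      using inj by (auto simp: doubleton_in_nsets_2 inj_on_def)
  qed
  have UE: "\<Union>E \<subseteq> V" using E by (auto simp: nsets_def)
  define q where "q = inv_into V \<pi>"
  have q: "q (\<pi> v) = v" if "v \<in> \<Union>E" for v
    using that UE inj by (auto simp: q_def)
  have im: "{\<pi> u, \<pi> v} \<in> (`) \<pi> ` E \<longleftrightarrow> {u, v} \<in> E" if "u \<in> \<Union>E" "v \<in> \<Union>E" for u v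
  proof
    assume "{\<pi> u, \<pi> v} \<in> (`) \<pi> ` E"
    then obtain e where "e \<in> E" "\<pi> ` {u, v} = \<pi> ` e" by auto
    moreover have "{u, v} \<subseteq> V" "e \<subseteq> V" using that UE \<open>e \<in> E\<close> by auto
    ultimately show "{u, v} \<in> E" using inj_on_image_eq_iff[OF inj] by metis
  next
    assume "{u, v} \<in> E"
    then have "\<pi> ` {u, v} \<in> (`) \<pi> ` E" by (rule imageI)
    then show "{\<pi> u, \<pi> v} \<in> (`) \<pi> ` E" by simp
  qed
  have U: "\<Union>((`) \<pi> ` E) = \<pi> ` \<Union>E" by blast
  show ?thesis
    unfolding cointerval_edge_induced_iff[OF finite_imageI[OF fin] sub]
  proof (rule exI[of _ "a \<circ> q"], rule exI[of _ "b \<circ> q"], intro conjI ballI impI)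
    fix v assume "v \<in> \<Union>((`) \<pi> ` E)"
    then show "(a \<circ> q) v \<le> (b \<circ> q) v" unfolding U using q ab by fastforce
  next
    fix u v assume "u \<in> \<Union>((`) \<pi> ` E)" "v \<in> \<Union>((`) \<pi> ` E)" and "u \<noteq> v"
    then obtain x y where xy: "u = \<pi> x" "v = \<pi> y" "x \<in> \<Union>E" "y \<in> \<Union>E" "x \<noteq> y"
      unfolding U by blast
    show "{u, v} \<in> (`) \<pi> ` E \<longleftrightarrow> (b \<circ> q) v < (a \<circ> q) u \<or> (b \<circ> q) u < (a \<circ> q) v"
      using im[OF xy(3,4)] iff[OF xy(3-5)] q[OF xy(3)] q[OF xy(4)] by (simp add: xy(1,2))
  qed
qed

section \<open>Fractional covers of finite hypergraphs\<close>

text \<open>A continuous weight attains its minimum on a nonempty compact set of covers. Attainment,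
  rather than an infimum, is what the \<open>LEAST\<close> in \<open>fractional_boxicity\<close>
  requires.\<close>

lemma fractional_cover_min:
  fixes H :: "'b hypergraph"
  assumes fin: "finite (edges H)" and ex: "fractional_cover H x0"
  shows "\<exists>x. fractional_cover H x \<and>
    (\<forall>y. fractional_cover H y \<longrightarrow> (\<Sum>F\<in>edges H. x F) \<le> (\<Sum>F\<in>edges H. y F))"
proof -
  let ?w = "\<lambda>x. \<Sum>F\<in>edges H. x F :: real"
  let ?c = "\<lambda>v x. \<Sum>F\<in>edges H. incidence H v F * x F"
  \<comment> \<open>Vectors are total functions, so coordinates that are not hyperedges are pinned
    to 0. Then \<open>K\<close> is a product of compact factors over \<open>UNIV\<close>, compact by
    Tychonoff.\<close>
  define K where "K = (\<Pi>\<^sub>E F\<in>UNIV. if F \<in> edges H then {0..1::real} else {0})"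
  define S where "S = K \<inter> (\<Inter>v\<in>verts H. {x. 1 \<le> ?c v x})"
  have "compactin (product_topology (\<lambda>_. euclidean) UNIV) K"
    unfolding K_def compactin_PiE by auto
  then have "compact K" by (simp add: euclidean_product_topology)
  moreover have "closed {x. 1 \<le> ?c v x}" for v
    by (intro closed_Collect_le continuous_intros continuous_on_product_coordinates)
  ultimately have "compact S" unfolding S_def by (intro compact_Int_closed closed_INT) auto
  have S_cover: "fractional_cover H x" if "x \<in> S" for x
    using that by (auto simp: S_def K_def fractional_cover_def PiE_iff split: if_splits)
  \<comment> \<open>Truncating at 1 preserves the covering constraints, so the minimum may be sought in the
    compact cube.\<close>
  have trunc: "\<exists>x\<in>S. ?w x \<le> ?w y" if y: "fractional_cover H y" for y
  proof -
    define x where "x F = (if F \<in> edges H then min (y F) 1 else 0)" for F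
    have y0: "0 \<le> y F" if "F \<in> edges H" for F using y that by (simp add: fractional_cover_def)
    then have x0: "0 \<le> x F" for F by (simp add: x_def)
    \<comment> \<open>Either some hyperedge at \<open>v\<close> had weight at least 1, and its
      truncated weight 1 alone covers \<open>v\<close>, or truncation changed no weight at
      \<open>v\<close>.\<close>
    have "1 \<le> ?c v x" if v: "v \<in> verts H" for v
    proof (cases "\<exists>F\<in>edges H. v \<in> F \<and> 1 \<le> y F")
      case True
      then obtain F where F: "F \<in> edges H" "v \<in> F" "1 \<le> y F" by blast
      have "1 = incidence H v F * x F" using F v by (simp add: incidence_def x_def)
      also have "\<dots> \<le> ?c v x"
        by (rule member_le_sum) (use F fin x0 in \<open>auto simp: incidence_def\<close>)
      finally show ?thesis .
    next
      case False
      then have "?c v x = ?c v y" by (intro sum.cong) (auto simp: incidence_def x_def)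
      then show ?thesis using y v by (simp add: fractional_cover_def)
    qed
    moreover have "x \<in> K"
      unfolding K_def PiE_iff using y0 by (simp add: x_def)
    ultimately have "x \<in> S" by (simp add: S_def)
    moreover have "?w x \<le> ?w y" by (intro sum_mono) (simp add: x_def)
    ultimately show ?thesis by blast
  qed
  have "S \<noteq> {}" using trunc[OF ex] by blast
  moreover have "continuous_on S ?w"
    by (intro continuous_intros continuous_on_product_coordinates)
       (auto intro: continuous_on_subset[OF continuous_on_product_coordinates])
  ultimately obtain x where "x \<in> S" "\<forall>y\<in>S. ?w x \<le> ?w y"
    using continuous_attains_inf[OF \<open>compact S\<close>] by blast
  then show ?thesis using S_cover trunc by (meson order_trans)
qed

lemma sum_incidence_verts:
  assumes "finite (verts H)" and "F \<in> edges H" and "F \<subseteq> verts H"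
  shows "(\<Sum>v\<in>verts H. incidence H v F) = real (card F)"
proof -
  have "(\<Sum>v\<in>verts H. incidence H v F) = (\<Sum>v\<in>verts H. if v \<in> F then 1 else 0)"
    using assms by (intro sum.cong) (auto simp: incidence_def)
  also have "\<dots> = real (card F)"
    using assms by (simp add: Int_absorb1 flip: sum.inter_restrict)
  finally show ?thesis .
qed

text \<open>Double counting: summing the constraints over all vertices gives at least
  \<open>card (verts H)\<close>, while each \<open>x F\<close> is counted \<open>card F\<close>
  times, hence at most \<open>m\<close> times.\<close>

lemma fractional_cover_weight_ge:
  assumes fin: "finite (verts H)" and sub: "\<And>F. F \<in> edges H \<Longrightarrow> F \<subseteq> verts H"
    and m: "\<And>F. F \<in> edges H \<Longrightarrow> card F \<le> m" and x: "fractional_cover H x"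
  shows "real (card (verts H)) / real m \<le> (\<Sum>F\<in>edges H. x F)"
proof -
  have x0: "\<And>F. F \<in> edges H \<Longrightarrow> 0 \<le> x F" using x by (simp add: fractional_cover_def)
  have "real (card (verts H)) \<le> (\<Sum>v\<in>verts H. \<Sum>F\<in>edges H. incidence H v F * x F)"
    using sum_bounded_below[of "verts H" "1 :: real"] x by (simp add: fractional_cover_def)
  also have "\<dots> = (\<Sum>F\<in>edges H. (\<Sum>v\<in>verts H. incidence H v F) * x F)"
    by (subst sum.swap) (simp add: sum_distrib_right)
  also have "\<dots> \<le> (\<Sum>F\<in>edges H. real m * x F)"
    using sum_incidence_verts[OF fin] sub m x0 by (intro sum_mono mult_right_mono) auto
  also have "\<dots> = real m * (\<Sum>F\<in>edges H. x F)" by (simp add: sum_distrib_left)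
  \<comment> \<open>For \<open>m = 0\<close> the quotient is 0 by convention, and nonnegativity of
    the weights suffices.\<close>
  finally show ?thesis using sum_nonneg[of "edges H" x] x0
    by (cases "m = 0") (auto simp: field_simps)
qed

lemma integral_cover:
  assumes fin: "finite (edges H)" and C: "C \<subseteq> edges H" and cov: "verts H \<subseteq> \<Union>C"
  shows "fractional_cover H (\<lambda>F. if F \<in> C then 1 else 0)"
  unfolding fractional_cover_def
proof (intro conjI ballI)
  fix v assume v: "v \<in> verts H"
  then obtain F where F: "F \<in> C" "v \<in> F" using cov by blast
  have "1 = incidence H v F * (if F \<in> C then 1 else 0)" using F C v by (auto simp: incidence_def)
  also have "\<dots> \<le> (\<Sum>F\<in>edges H. incidence H v F * (if F \<in> C then 1 else 0))"
    by (rule member_le_sum) (use F fin C in \<open>auto simp: incidence_def\<close>)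
  finally show "1 \<le> (\<Sum>F\<in>edges H. incidence H v F * (if F \<in> C then 1 else 0))" .
qed simp

text \<open>Weight \<open>1 / d\<close> on each member of \<open>T\<close> covers every vertex
  exactly once. Counting incidences between vertices and \<open>T\<close> in two ways gives
  \<open>card (verts H) * d = card T * m\<close>, so the total weight \<open>card T / d\<close> is
  the claimed quotient.\<close>

lemma fractional_cover_uniform:
  assumes fin: "finite (verts H)" "finite (edges H)" and sub: "\<And>F. F \<in> edges H \<Longrightarrow> F \<subseteq> verts H"
    and T: "T \<subseteq> edges H" "T \<noteq> {}" and card_T: "\<And>F. F \<in> T \<Longrightarrow> card F = m" and m: "m > 0"
    and deg: "\<And>v. v \<in> verts H \<Longrightarrow> card {F \<in> T. v \<in> F} = d"
  shows "\<exists>x. fractional_cover H x \<and> (\<Sum>F\<in>edges H. x F) = real (card (verts H)) / real m"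
proof -
  have finT: "finite T" using T fin finite_subset by blast
  have inc: "(\<Sum>F\<in>T. incidence H v F) = real d" if v: "v \<in> verts H" for v
  proof -
    have "(\<Sum>F\<in>T. incidence H v F) = (\<Sum>F\<in>T. if v \<in> F then 1 else 0)"
      using T v by (intro sum.cong) (auto simp: incidence_def)
    also have "\<dots> = real (card {F \<in> T. v \<in> F})"
      using finT by (simp flip: sum.inter_filter)
    finally show ?thesis using deg[OF v] by simp
  qed
  have "real (card (verts H)) * d = (\<Sum>v\<in>verts H. \<Sum>F\<in>T. incidence H v F)" using inc by simp
  also have "\<dots> = (\<Sum>F\<in>T. \<Sum>v\<in>verts H. incidence H v F)" by (rule sum.swap)
  also have "\<dots> = (\<Sum>F\<in>T. real m)"
    using sum_incidence_verts[OF fin(1)] sub T(1) card_T by (intro sum.cong) auto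
  finally have count: "real (card (verts H)) * d = real (card T) * m" by simp
  have "card T > 0" using finT T by (simp add: card_gt_0_iff)
  \<comment> \<open>If \<open>d\<close> were 0, the count would force \<open>card T * m = 0\<close>,
    but both factors are positive.\<close>
  then have d: "d > 0" using count m by (cases "d = 0") auto
  define x where "x F = (if F \<in> T then 1 / real d else 0)" for F
  \<comment> \<open>Applied with \<open>g\<close> an incidence row for the constraints, and with
    \<open>g\<close> constantly 1 for the total weight.\<close>
  have restr: "(\<Sum>F\<in>edges H. g F * x F) = (\<Sum>F\<in>T. g F) / d" for g
  proof -
    have "(\<Sum>F\<in>edges H. g F * x F) = (\<Sum>F\<in>T. g F * x F)"
      using fin T by (intro sum.mono_neutral_right) (auto simp: x_def)
    also have "\<dots> = (\<Sum>F\<in>T. g F) / d" by (simp add: x_def sum_divide_distrib)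
    finally show ?thesis .
  qed
  have "fractional_cover H x"
    using restr inc d by (simp add: fractional_cover_def x_def[of F for F])
  moreover have "(\<Sum>F\<in>edges H. x F) = real (card T) / d" using restr[of "\<lambda>_. 1"] by simp
  moreover have "real (card T) / d = real (card (verts H)) / real m"
    using count d m by (simp add: frac_eq_eq)
  ultimately show ?thesis by auto
qed

section \<open>The cointerval hypergraph\<close>

lemma verts_cointerval_hypergraph:
  "verts (cointerval_hypergraph G) = edges (graph_complement G)"
  by (simp add: cointerval_hypergraph_def)

lemma edges_cointerval_hypergraph:
  "edges (cointerval_hypergraph G) =
    {E. E \<subseteq> edges (graph_complement G) \<and> cointerval_graph (edge_induced E)}"
  by (simp add: cointerval_hypergraph_def)

lemma edges_graph_complement: "edges (graph_complement G) = nsets (verts G) 2 - edges G"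
  by (simp add: graph_complement_def)

lemma finite_cointerval_hypergraph:
  assumes "finite (verts G)"
  shows "finite (verts (cointerval_hypergraph G))" "finite (edges (cointerval_hypergraph G))"
  using assms
  by (auto simp: verts_cointerval_hypergraph edges_cointerval_hypergraph edges_graph_complement
      finite_imp_finite_nsets)

lemma cointerval_hypergraph_single:
  assumes "e \<in> edges (graph_complement G)"
  shows "{e} \<in> edges (cointerval_hypergraph G)"
  using assms cointerval_edge_induced_single[of e "verts G"]
  by (simp add: edges_cointerval_hypergraph edges_graph_complement)

lemma cointerval_hypergraph_image:
  assumes fin: "finite (verts G)" and iso: "graph_iso \<pi> (graph_complement G) (graph_complement G)"
    and F: "F \<in> edges (cointerval_hypergraph G)"
  shows "(`) \<pi> ` F \<in> edges (cointerval_hypergraph G)"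
proof -
  have "inj_on \<pi> (verts G)"
    using iso by (simp add: graph_iso_def bij_betw_def graph_complement_def)
  moreover have "F \<subseteq> nsets (verts G) 2" "cointerval_graph (edge_induced F)"
    using F by (auto simp: edges_cointerval_hypergraph edges_graph_complement)
  moreover have "(`) \<pi> ` F \<subseteq> edges (graph_complement G)"
    using iso F unfolding graph_iso_def edges_cointerval_hypergraph by blast
  ultimately show ?thesis
    using cointerval_edge_induced_image[OF fin] by (simp add: edges_cointerval_hypergraph)
qed

text \<open>Each non-edge of \<open>G\<close> is separated in some coordinate. The pairs separated
  in coordinate \<open>i\<close> form a hyperedge, because the \<open>i\<close>-th sides of the
  boxes are an interval model for them.\<close>

lemma box_representable_imp_cover:
  assumes G: "simple_graph G" and rep: "box_representable G k"
  shows "\<exists>C. C \<subseteq> edges (cointerval_hypergraph G) \<and> edges (graph_complement G) \<subseteq> \<Union>C \<and> card C \<le> k"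
proof -
  have fin: "finite (verts G)" and sub: "edges G \<subseteq> nsets (verts G) 2"
    using G by (auto simp: simple_graph_def)
  obtain a b :: "'a \<Rightarrow> nat \<Rightarrow> real" where ab: "\<forall>v\<in>verts G. \<forall>i<k. a v i \<le> b v i"
    and E: "\<And>u v. u \<in> verts G \<Longrightarrow> v \<in> verts G \<Longrightarrow> u \<noteq> v \<Longrightarrow>
        ({u, v} \<in> edges G \<longleftrightarrow> (\<forall>i<k. a u i \<le> b v i \<and> a v i \<le> b u i))"
    using rep unfolding box_representable_iff[OF sub] by blast
  \<comment> \<open>One strict inequality is enough: the pair is unordered, so exchanging
    \<open>u\<close> and \<open>v\<close> gives the other orientation.\<close>
  define P where "P i = {{u, v} | u v. u \<in> verts G \<and> v \<in> verts G \<and> u \<noteq> v \<and> b v i < a u i}" for i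
  have P_sub: "P i \<subseteq> edges (graph_complement G)" if "i < k" for i
    using that E by (fastforce simp: P_def edges_graph_complement doubleton_in_nsets_2)
  have P_iff: "{u, v} \<in> P i \<longleftrightarrow> b v i < a u i \<or> b u i < a v i"
    if "u \<in> verts G" "v \<in> verts G" "u \<noteq> v" for u v i
    using that by (auto simp: P_def doubleton_eq_iff)
  have "P i \<in> edges (cointerval_hypergraph G)" if i: "i < k" for i
  proof -
    have ns: "P i \<subseteq> nsets (verts G) 2" using P_sub[OF i] by (auto simp: edges_graph_complement)
    have U: "\<Union>(P i) \<subseteq> verts G" by (auto simp: P_def)
    have "cointerval_graph (edge_induced (P i))"
      unfolding cointerval_edge_induced_iff[OF fin ns]
    proof (rule exI[of _ "\<lambda>v. a v i"], rule exI[of _ "\<lambda>v. b v i"], intro conjI ballI impI)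
      show "a v i \<le> b v i" if "v \<in> \<Union>(P i)" for v using that ab i U by blast
      show "{u, v} \<in> P i \<longleftrightarrow> b v i < a u i \<or> b u i < a v i"
        if "u \<in> \<Union>(P i)" "v \<in> \<Union>(P i)" "u \<noteq> v" for u v
        using that U by (intro P_iff) auto
    qed
    then show ?thesis using P_sub[OF i] by (simp add: edges_cointerval_hypergraph)
  qed
  moreover have "edges (graph_complement G) \<subseteq> \<Union>(P ` {..<k})"
  proof
    fix e assume e: "e \<in> edges (graph_complement G)"
    then obtain u v where uv: "e = {u, v}" "u \<in> verts G" "v \<in> verts G" "u \<noteq> v"
      unfolding edges_graph_complement by (meson DiffD1 nsets2_E)
    have "{u, v} \<notin> edges G" using e uv by (simp add: edges_graph_complement)
    then obtain i where "i < k" "b v i < a u i \<or> b u i < a v i" using E[OF uv(2-4)] by force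
    then show "e \<in> \<Union>(P ` {..<k})" using P_iff[OF uv(2-4)] uv(1) by blast
  qed
  \<comment> \<open>Different coordinates may separate the same pairs, so only an inequality
    holds.\<close>
  moreover have "card (P ` {..<k}) \<le> k" using card_image_le[of "{..<k}" P] by simp
  ultimately show ?thesis by (intro exI[of _ "P ` {..<k}"]) blast
qed

text \<open>Replaces the \<open>LEAST\<close> by its two usable properties: some cover attains the
  value, and no cover has smaller weight.\<close>

lemma fractional_boxicity_attained:
  assumes "finite (verts G)"
  shows "\<exists>x. fractional_cover (cointerval_hypergraph G) x \<and>
      fractional_boxicity G = (\<Sum>F\<in>edges (cointerval_hypergraph G). x F)"
    and "\<And>x. fractional_cover (cointerval_hypergraph G) x \<Longrightarrow>
      fractional_boxicity G \<le> (\<Sum>F\<in>edges (cointerval_hypergraph G). x F)"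
proof -
  let ?H = "cointerval_hypergraph G"
  note fin = finite_cointerval_hypergraph[OF assms]
  have "fractional_cover ?H (\<lambda>F. if F \<in> edges ?H then 1 else 0)"
    using cointerval_hypergraph_single
    by (intro integral_cover[OF fin(2)]) (auto simp: verts_cointerval_hypergraph)
  from fractional_cover_min[OF fin(2) this]
  obtain x where x: "fractional_cover ?H x"
      "\<And>y. fractional_cover ?H y \<Longrightarrow> (\<Sum>F\<in>edges ?H. x F) \<le> (\<Sum>F\<in>edges ?H. y F)"
    by blast
  then have eq: "fractional_boxicity G = (\<Sum>F\<in>edges ?H. x F)"
    unfolding fractional_boxicity_def by (intro Least_equality) auto
  show "\<exists>x. fractional_cover ?H x \<and> fractional_boxicity G = (\<Sum>F\<in>edges ?H. x F)"
    using x eq by blast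
  show "fractional_boxicity G \<le> (\<Sum>F\<in>edges ?H. y F)" if "fractional_cover ?H y" for y
    using x(2)[OF that] eq by simp
qed

text \<open>An automorphism taking \<open>e\<close> to \<open>e'\<close> acts on hyperedges
  injectively, preserves their size, and sends those containing \<open>e\<close> to hyperedges
  containing \<open>e'\<close>.\<close>

lemma edge_transitive_card_le:
  assumes fin: "finite (verts G)" and trans: "edge_transitive (graph_complement G)"
    and e: "e \<in> edges (graph_complement G)" "e' \<in> edges (graph_complement G)"
  shows "card {F \<in> edges (cointerval_hypergraph G). card F = m \<and> e \<in> F}
    \<le> card {F \<in> edges (cointerval_hypergraph G). card F = m \<and> e' \<in> F}" (is "card ?A \<le> card ?A'")
proof -
  obtain \<pi> where iso: "graph_iso \<pi> (graph_complement G) (graph_complement G)" and \<pi>: "\<pi> ` e = e'"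
    using trans e unfolding edge_transitive_def by blast
  have inj: "inj_on \<pi> (verts G)"
    using iso by (simp add: graph_iso_def bij_betw_def graph_complement_def)
  have sub: "F \<subseteq> Pow (verts G)" if "F \<in> edges (cointerval_hypergraph G)" for F
    using that by (auto simp: edges_cointerval_hypergraph edges_graph_complement nsets_def)
  \<comment> \<open>Injectivity is lifted twice through power sets: from vertices to edges here,
    then from edges to sets of edges.\<close>
  have inj2: "inj_on ((`) \<pi>) (Pow (verts G))" using inj by (rule inj_on_image_Pow)
  have "inj_on ((`) ((`) \<pi>)) ?A"
    by (rule inj_on_subset[OF inj_on_image_Pow[OF inj2]]) (use sub in blast)
  moreover have "(`) ((`) \<pi>) ` ?A \<subseteq> ?A'"
  proof
    fix F' assume "F' \<in> (`) ((`) \<pi>) ` ?A"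
    then obtain F where F: "F \<in> ?A" "F' = (`) \<pi> ` F" by blast
    have "card F' = card F"
      unfolding F(2) using inj_on_subset[OF inj2 sub] F(1) by (auto intro: card_image)
    then show "F' \<in> ?A'"
      using F \<pi> cointerval_hypergraph_image[OF fin iso] by auto
  qed
  moreover have "finite ?A'" using finite_cointerval_hypergraph(2)[OF fin] by simp
  ultimately show ?thesis by (rule card_inj_on_le)
qed

theorem theorem2p1:
  fixes G :: "'a hypergraph"
  assumes "simple_graph G" and "\<not> complete_graph G"
  shows "real (boxicity G) \<ge> fractional_boxicity G \<and>
         fractional_boxicity G \<ge> real (card (edges (graph_complement G))) /
           real (Max (card ` edges (cointerval_hypergraph G))) \<and>
         (edge_transitive (graph_complement G) \<longrightarrow>
           fractional_boxicity G = real (card (edges (graph_complement G))) /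
             real (Max (card ` edges (cointerval_hypergraph G))))"
proof -
  have finV: "finite (verts G)" and sub: "edges G \<subseteq> nsets (verts G) 2"
    using assms by (auto simp: simple_graph_def)
  define H where "H = cointerval_hypergraph G"
  define m where "m = Max (card ` edges H)"
  note fin = finite_cointerval_hypergraph[OF finV, folded H_def]
  note attained = fractional_boxicity_attained[OF finV, folded H_def]
  have vH: "verts H = edges (graph_complement G)"
    unfolding H_def by (rule verts_cointerval_hypergraph)
  have subH: "F \<subseteq> verts H" if "F \<in> edges H" for F
    using that by (simp add: H_def verts_cointerval_hypergraph edges_cointerval_hypergraph)
  have le_m: "card F \<le> m" if "F \<in> edges H" for F
    using that fin by (simp add: m_def)
  \<comment> \<open>Non-completeness enters here: \<open>e\<close> makes the denominator
    \<open>m\<close> positive and later serves as the reference edge for degrees.\<close>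
  obtain e where e: "e \<in> edges (graph_complement G)"
    using assms sub by (auto simp: complete_graph_def edges_graph_complement)
  then have eH: "{e} \<in> edges H" unfolding H_def by (rule cointerval_hypergraph_single)
  have m: "m > 0" using le_m[OF eH] by simp

  have "box_representable G (boxicity G)"
    unfolding boxicity_def using ex_box_representable[OF finV sub] by (rule LeastI_ex)
  then obtain C where C: "C \<subseteq> edges H" "verts H \<subseteq> \<Union>C" "card C \<le> boxicity G"
    using box_representable_imp_cover[OF assms(1)] unfolding vH H_def[symmetric] by metis
  have "fractional_boxicity G \<le> (\<Sum>F\<in>edges H. if F \<in> C then 1 else 0)"
    using integral_cover[OF fin(2) C(1,2)] by (rule attained(2))
  also have "\<dots> = real (card C)"
    using C(1) fin(2) by (simp add: Int_absorb1 flip: sum.inter_restrict)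
  finally have upper: "fractional_boxicity G \<le> real (boxicity G)" using C(3) by linarith

  have lower: "real (card (verts H)) / real m \<le> fractional_boxicity G"
    using attained(1) fractional_cover_weight_ge[OF fin(1) subH le_m] by force

  have "fractional_boxicity G \<le> real (card (verts H)) / real m"
    if trans: "edge_transitive (graph_complement G)"
  proof -
    let ?T = "{F \<in> edges H. card F = m}"
    have "m \<in> card ` edges H" unfolding m_def using fin eH by (intro Max_in) auto
    then have ne: "?T \<noteq> {}" by auto
    \<comment> \<open>The common degree \<open>d\<close> is that of \<open>e\<close>; using
      transitivity in both directions gives equality.\<close>
    have "card {F \<in> ?T. v \<in> F} = card {F \<in> ?T. e \<in> F}" if v: "v \<in> verts H" for v
    proof -
      have v': "v \<in> edges (graph_complement G)" using v unfolding vH .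
      note le = edge_transitive_card_le[OF finV trans, folded H_def]
      have "card {F \<in> edges H. card F = m \<and> v \<in> F} = card {F \<in> edges H. card F = m \<and> e \<in> F}"
        by (rule order.antisym) (rule le[OF v' e], rule le[OF e v'])
      then show ?thesis by simp
    qed
    then have "\<exists>x. fractional_cover H x \<and> (\<Sum>F\<in>edges H. x F) = real (card (verts H)) / real m"
      using ne by (intro fractional_cover_uniform[OF fin subH, where T = ?T]) (use m in auto)
    then show ?thesis using attained(2) by metis
  qed
  then show ?thesis
    using upper lower unfolding vH[symmetric] H_def[symmetric] m_def[symmetric]
    by (simp add: order.antisym)
qed

end
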